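(* Let $\beta$ and $t$ be real numbers with $t>0$. Then $$\sum_{n=0}^\infty\left(\frac{\beta^2}{1+\beta^2}\right)^n\frac{\gamma\left(n+\tfrac12,(1+\beta^2)t\right)}{\Gamma\left(n+\tfrac12\right)}=(1+\beta^2)\,\mathrm{erf}\left(\sqrt{(1+\beta^2)t}\right)-e^{-t}\beta\sqrt{1+\beta^2}\;\mathrm{erf}\left(\beta\sqrt{t}\right).$$
   Context: For real $x$, $\mathrm{erf}(x)=\frac{2}{\sqrt{\pi}}\int_0^x e^{-s^2}\,ds$. For real $x>0$ and $y\ge 0$, $\gamma(x,y)=\int_0^y s^{x-1}e^{-s}\,ds$ (lower incomplete gamma function). For real $x>0$, $\Gamma(x)=\int_0^\infty s^{x-1}e^{-s}\,ds$. The $n=0$ power in the series is read as $1$, including when $\beta=0$. *)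

theory Defs
  imports "HOL-Analysis.Analysis"
begin

text \<open>
  The interval integral is oriented, so for negative \<open>x\<close> the value is minus the integral
  from \<open>x\<close> to \<open>0\<close>.
\<close>
definition erf :: "real \<Rightarrow> real" where
  "erf x = 2 / sqrt pi * (LBINT s=ereal 0..ereal x. exp (- (s\<^sup>2)))"

text \<open>
  Meant for \<open>x > 0\<close> and \<open>y \<ge> 0\<close>.
\<close>
definition lower_Gamma :: "real \<Rightarrow> real \<Rightarrow> real" where
  "lower_Gamma x y = (LBINT s=ereal 0..ereal y. s powr (x - 1) * exp (- s))"

end

theory Submission
  imports Defs
begin

text \<open>
  Write \<open>P n y = lower_Gamma (n + 1/2) y / Gamma (n + 1/2)\<close>. Integration by parts shows that
  \<open>P n y - P (n + 1) y\<close> equals \<open>exp (-y) * y powr (n + 1/2) / Gamma (n + 3/2)\<close>, and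
  \<open>P n y\<close> is summable in \<open>n\<close> by the ratio test. Telescoping from \<open>P 0 y = erf (sqrt y)\<close> therefore
  expands \<open>exp y * erf (sqrt y)\<close> in the powers \<open>y powr (n + 1/2)\<close>. On the other hand, summation by
  parts of \<open>S = (\<Sum>n. q ^ n * P n y)\<close> expresses \<open>(1 - q) * S\<close> through \<open>P 0 y\<close> and the same
  power series at \<open>q * y\<close>. With \<open>q = \<beta>\<^sup>2 / (1 + \<beta>\<^sup>2)\<close> and \<open>y = (1 + \<beta>\<^sup>2) * t\<close>
  one has \<open>1 - q = 1 / (1 + \<beta>\<^sup>2)\<close> and \<open>q * y = \<beta>\<^sup>2 * t\<close>.
\<close>

section \<open>Error function: integral form, oddness, derivative\<close>

lemma interval_integral_eq_integral_nonneg: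
  fixes f :: "real \<Rightarrow> real"
  assumes "a \<le> b" "f integrable_on {a..b}" "f \<in> borel_measurable borel"
    and "\<And>x. x \<in> {a..b} \<Longrightarrow> f x \<ge> 0"
  shows "(LBINT x=ereal a..ereal b. f x) = integral {a..b} f"
proof (rule interval_integral_eq_integral)
  \<comment> \<open>For a nonnegative function gauge integrability already gives absolute
    integrability, so integrands unbounded at an endpoint are covered, such as
    \<open>s powr (x - 1)\<close> for x < 1. Borel measurability then allows passing from the
    completed measure to \<open>lborel\<close>.\<close>
  have "f absolutely_integrable_on {a..b}"
    using assms by (intro nonnegative_absolutely_integrable_1) auto
  then show "set_integrable lborel {a..b} f"
    using assms(3) unfolding set_integrable_def
    by (subst (asm) integrable_completion) auto
qed (use assms in auto)

lemma erf_eq_integral: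
  assumes "x \<ge> 0"
  shows "erf x = 2 / sqrt pi * integral {0..x} (\<lambda>s. exp (- (s\<^sup>2)))"
  unfolding erf_def using assms
  by (subst interval_integral_eq_integral_nonneg)
     (auto intro!: integrable_continuous_interval continuous_intros)

text \<open>Needed twice: it yields \<open>erf 0 = 0\<close>, and it removes the absolute value that
  \<beta> acquires through \<open>sqrt (\<beta>\<^sup>2)\<close>.\<close>

lemma erf_minus: "erf (- x) = - erf x"
proof -
  have "(LBINT s=ereal 0..ereal (- x). exp (- (s\<^sup>2))) = (LBINT s=ereal x..ereal 0. exp (- (s\<^sup>2)))"
    by (subst interval_integral_reflect) simp
  then show ?thesis
    unfolding erf_def
    by (subst (asm) interval_integral_endpoints_reverse) simp
qed

lemma erf_has_real_derivative:
  assumes "x > 0"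
  shows "(erf has_real_derivative 2 / sqrt pi * exp (- (x\<^sup>2))) (at x)"
proof -
  have "((\<lambda>u. integral {0..u} (\<lambda>s. exp (- (s\<^sup>2)))) has_real_derivative exp (- (x\<^sup>2)))
          (at x within {0..x + 1})"
    using assms by (intro integral_has_real_derivative continuous_intros) auto
  \<comment> \<open>The upper end \<open>x + 1\<close> makes x an interior point, so the derivative
    within the interval is a full derivative.\<close>
  then have "((\<lambda>u. integral {0..u} (\<lambda>s. exp (- (s\<^sup>2)))) has_real_derivative exp (- (x\<^sup>2))) (at x)"
    using assms by (subst (asm) at_within_interior) auto
  then have "((\<lambda>u. 2 / sqrt pi * integral {0..u} (\<lambda>s. exp (- (s\<^sup>2)))) has_real_derivative
      2 / sqrt pi * exp (- (x\<^sup>2))) (at x)"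
    by (rule DERIV_cmult)
  then show ?thesis
    by (rule has_field_derivative_transform_within_open[of _ _ _ "{0<..}"])
       (use assms in \<open>auto simp: erf_eq_integral\<close>)
qed

lemma continuous_on_erf: "continuous_on {0..a} erf"
proof -
  have "continuous_on {0..a} (\<lambda>u. 2 / sqrt pi * integral {0..u} (\<lambda>s. exp (- (s\<^sup>2))))"
    by (intro continuous_intros indefinite_integral_continuous_1 integrable_continuous_interval)
  then show ?thesis
    by (subst continuous_on_cong[OF refl erf_eq_integral]) auto
qed

section \<open>Lower incomplete gamma function\<close>

lemma lower_Gamma_has_integral:
  assumes "x > 0" "y \<ge> 0"
  shows "((\<lambda>s. s powr (x - 1) * exp (- s)) has_integral lower_Gamma x y) {0..y}"
proof -
  \<comment> \<open>Euler's integral for \<open>Gamma\<close> settles integrability at the possible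
    singularity 0.\<close>
  have "(\<lambda>s. s powr (x - 1) / exp s) integrable_on {0..}"
    using Gamma_integral_real[OF assms(1)] by blast
  then have "(\<lambda>s. s powr (x - 1) * exp (- s)) integrable_on {0..}"
    by (simp add: exp_minus divide_inverse)
  then have int: "(\<lambda>s. s powr (x - 1) * exp (- s)) integrable_on {0..y}"
    by (rule integrable_on_subinterval) auto
  have "lower_Gamma x y = integral {0..y} (\<lambda>s. s powr (x - 1) * exp (- s))"
    unfolding lower_Gamma_def
    using assms int by (intro interval_integral_eq_integral_nonneg) auto
  then show ?thesis
    using int by (simp add: has_integral_iff)
qed

lemma lower_Gamma_nonneg:
  assumes "x > 0" "y \<ge> 0"
  shows "lower_Gamma x y \<ge> 0"
  using lower_Gamma_has_integral[OF assms] by (rule has_integral_nonneg) auto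

text \<open>This is the substitution s = u^2, carried out by exhibiting an antiderivative. The
  integrand blows up at 0, so differentiability is used only in the open interval and continuity up
  to its ends.\<close>

lemma lower_Gamma_half:
  assumes "y \<ge> 0"
  shows "lower_Gamma (1/2) y = sqrt pi * erf (sqrt y)"
proof -
  have "((\<lambda>s. s powr (1/2 - 1) * exp (- s)) has_integral
      (sqrt pi * erf (sqrt y) - sqrt pi * erf (sqrt 0))) {0..y}"
  proof (rule fundamental_theorem_of_calculus_interior)
    have "continuous_on {0..y} (\<lambda>s. erf (sqrt s))"
      by (rule continuous_on_compose2[OF continuous_on_erf[of "sqrt y"]])
         (auto intro!: continuous_intros)
    then show "continuous_on {0..y} (\<lambda>s. sqrt pi * erf (sqrt s))"
      by (intro continuous_intros)
  next
    fix s assume s: "s \<in> {0<..<y}"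
    have "((\<lambda>s. sqrt pi * erf (sqrt s)) has_real_derivative
            sqrt pi * (2 / sqrt pi * exp (- ((sqrt s)\<^sup>2)) * (inverse (sqrt s) / 2))) (at s)"
      using s by (intro DERIV_cmult DERIV_chain2[OF erf_has_real_derivative] DERIV_real_sqrt) auto
    moreover have "s powr (1/2 - 1) = inverse (sqrt s)"
      using s powr_minus[of s "1/2"] by (simp add: powr_half_sqrt)
    then have "sqrt pi * (2 / sqrt pi * exp (- ((sqrt s)\<^sup>2)) * (inverse (sqrt s) / 2)) =
            s powr (1/2 - 1) * exp (- s)"
      using s by (simp only:) simp
    ultimately show "((\<lambda>s. sqrt pi * erf (sqrt s)) has_vector_derivative
            s powr (1/2 - 1) * exp (- s)) (at s)"
      by (simp only: has_real_derivative_iff_has_vector_derivative)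
  qed (use assms in auto)
  moreover have "erf (sqrt 0) = 0"
    using erf_minus[of 0] by simp
  ultimately show ?thesis
    using has_integral_unique[OF lower_Gamma_has_integral[of "1/2" y]] assms by simp
qed

text \<open>Integrate the derivative of \<open>s powr x * exp (- s)\<close>; its boundary term at 0
  vanishes.\<close>

lemma lower_Gamma_plus1:
  assumes "x > 0" "y \<ge> 0"
  shows "lower_Gamma (x + 1) y = x * lower_Gamma x y - y powr x * exp (- y)"
proof -
  have "((\<lambda>s. x * (s powr (x - 1) * exp (- s)) - s powr (x + 1 - 1) * exp (- s)) has_integral
      (y powr x * exp (- y) - 0 powr x * exp (- 0))) {0..y}"
  proof (rule fundamental_theorem_of_calculus_interior)
    show "continuous_on {0..y} (\<lambda>s. s powr x * exp (- s))"
      using assms by (intro continuous_intros continuous_on_powr') auto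
  next
    fix s assume s: "s \<in> {0<..<y}"
    have "((\<lambda>s. s powr x * exp (- s)) has_real_derivative
        x * (s powr (x - 1) * exp (- s)) - s powr (x + 1 - 1) * exp (- s)) (at s)"
      using s by (auto intro!: derivative_eq_intros simp: powr_diff field_simps)
    then show "((\<lambda>s. s powr x * exp (- s)) has_vector_derivative
        x * (s powr (x - 1) * exp (- s)) - s powr (x + 1 - 1) * exp (- s)) (at s)"
      by (simp add: has_real_derivative_iff_has_vector_derivative)
  qed (use assms in auto)
  moreover have "((\<lambda>s. x * (s powr (x - 1) * exp (- s)) - s powr (x + 1 - 1) * exp (- s))
      has_integral (x * lower_Gamma x y - lower_Gamma (x + 1) y)) {0..y}"
    using assms by (intro has_integral_diff has_integral_mult_right lower_Gamma_has_integral) auto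
  ultimately have "y powr x * exp (- y) - 0 powr x * exp (- 0) = x * lower_Gamma x y - lower_Gamma (x + 1) y"
    by (rule has_integral_unique)
  then show ?thesis
    by simp
qed

text \<open>One factor s of the integrand is bounded by y. This crude estimate feeds the ratio
  test.\<close>

lemma lower_Gamma_plus1_le:
  assumes "x > 0" "y \<ge> 0"
  shows "lower_Gamma (x + 1) y \<le> y * lower_Gamma x y"
proof (rule has_integral_le)
  show "((\<lambda>s. s powr (x + 1 - 1) * exp (- s)) has_integral lower_Gamma (x + 1) y) {0..y}"
    using assms by (intro lower_Gamma_has_integral) auto
  show "((\<lambda>s. y * (s powr (x - 1) * exp (- s))) has_integral y * lower_Gamma x y) {0..y}"
    using assms by (intro has_integral_mult_right lower_Gamma_has_integral) auto
next
  fix s assume s: "s \<in> {0..y}"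
  then have "s powr (x + 1 - 1) = s * s powr (x - 1)"
    using powr_mult_base[of s "x - 1"] by simp
  also have "\<dots> \<le> y * s powr (x - 1)"
    using s by (intro mult_right_mono) auto
  finally show "s powr (x + 1 - 1) * exp (- s) \<le> y * (s powr (x - 1) * exp (- s))"
    by (simp add: mult.assoc[symmetric])
qed

section \<open>Regularized lower incomplete gamma function at half-integers\<close>

definition reg_Gamma_half :: "nat \<Rightarrow> real \<Rightarrow> real" where
  "reg_Gamma_half n y = lower_Gamma (real n + 1/2) y / Gamma (real n + 1/2)"

lemma Gamma_half_Suc:
  "Gamma (real (Suc n) + 1/2) = (real n + 1/2) * Gamma (real n + 1/2)"
proof -
  have "real n + 1/2 \<notin> \<int>\<^sub>\<le>\<^sub>0"
  proof
    assume "real n + 1/2 \<in> \<int>\<^sub>\<le>\<^sub>0"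
    then have "real n + 1/2 \<le> 0" by (rule nonpos_Ints_nonpos)
    then show False by simp
  qed
  from Gamma_plus1[OF this] show ?thesis
    by (simp add: add_ac)
qed

lemma Gamma_half_pos: "Gamma (real n + 1/2) > 0"
  by (intro Gamma_real_pos) simp

lemma reg_Gamma_half_0:
  assumes "y \<ge> 0"
  shows "reg_Gamma_half 0 y = erf (sqrt y)"
  using lower_Gamma_half[OF assms] by (simp add: reg_Gamma_half_def Gamma_one_half_real)

lemma reg_Gamma_half_diff:
  assumes "y \<ge> 0"
  shows "reg_Gamma_half n y - reg_Gamma_half (Suc n) y =
           exp (- y) * (y powr (real n + 1/2) / Gamma (real (Suc n) + 1/2))"
proof -
  have "lower_Gamma (real (Suc n) + 1/2) y =
      (real n + 1/2) * lower_Gamma (real n + 1/2) y - y powr (real n + 1/2) * exp (- y)"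
    using lower_Gamma_plus1[of "real n + 1/2" y] assms by (simp add: add_ac)
  \<comment> \<open>Dividing the recurrence by \<open>Gamma (real (Suc n) + 1/2)\<close> is a pure
    field identity once the special functions are replaced by letters.\<close>
  moreover have "L / G - (x * L - p * e) / (x * G) = e * (p / (x * G))"
    if "x > 0" "G > 0" for L G x p e :: real
    using that by (simp add: field_simps)
  ultimately show ?thesis
    using Gamma_half_pos[of n] unfolding reg_Gamma_half_def Gamma_half_Suc by simp
qed

lemma reg_Gamma_half_nonneg:
  assumes "y \<ge> 0"
  shows "reg_Gamma_half n y \<ge> 0"
  unfolding reg_Gamma_half_def using assms Gamma_half_pos[of n]
  by (intro divide_nonneg_pos lower_Gamma_nonneg) auto

text \<open>Serves both as the source of the limit 0 in the telescoping sum and as a majorant for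
  the series weighted by \<open>q ^ n\<close>.\<close>

lemma summable_reg_Gamma_half:
  assumes "y \<ge> 0"
  shows "summable (\<lambda>n. reg_Gamma_half n y)"
proof (rule summable_ratio_test)
  \<comment> \<open>From this index on 2 * y \<le> n, so consecutive terms shrink by a factor of at
    most 1/2.\<close>
  fix n assume n: "n \<ge> nat \<lceil>2 * y\<rceil>"
  then have y: "y / (real n + 1/2) \<le> 1/2"
    by (simp add: field_simps)
  have "reg_Gamma_half (Suc n) y \<le>
      y * lower_Gamma (real n + 1/2) y / Gamma (real (Suc n) + 1/2)"
    unfolding reg_Gamma_half_def
    using lower_Gamma_plus1_le[of "real n + 1/2" y] assms Gamma_half_pos[of "Suc n"]
    by (intro divide_right_mono) (auto simp: add_ac)
  also have "\<dots> = y / (real n + 1/2) * reg_Gamma_half n y"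
    by (simp only: reg_Gamma_half_def Gamma_half_Suc) simp
  also have "\<dots> \<le> 1/2 * reg_Gamma_half n y"
    using y by (intro mult_right_mono reg_Gamma_half_nonneg assms)
  finally show "norm (reg_Gamma_half (Suc n) y) \<le> 1/2 * norm (reg_Gamma_half n y)"
    using reg_Gamma_half_nonneg[OF assms] by simp
qed simp

section \<open>Power series and the weighted sum\<close>

lemma exp_mult_erf_sqrt_sums:
  assumes "y \<ge> 0"
  shows "(\<lambda>n. y powr (real n + 1/2) / Gamma (real (Suc n) + 1/2)) sums (exp y * erf (sqrt y))"
proof -
  have "(\<lambda>n. reg_Gamma_half n y) \<longlonglongrightarrow> 0"
    using assms by (intro summable_LIMSEQ_zero summable_reg_Gamma_half)
  then have "(\<lambda>n. reg_Gamma_half n y - reg_Gamma_half (Suc n) y) sums (reg_Gamma_half 0 y - 0)"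
    by (rule telescope_sums')
  then have "(\<lambda>n. exp y * (exp (- y) * (y powr (real n + 1/2) / Gamma (real (Suc n) + 1/2))))
      sums (exp y * erf (sqrt y))"
    using assms by (intro sums_mult) (simp add: reg_Gamma_half_diff reg_Gamma_half_0)
  then show ?thesis
    by (simp add: mult.assoc[symmetric] exp_add[symmetric])
qed

lemma power_mult_reg_Gamma_half_sums:
  assumes "0 \<le> q" "q < 1" "y \<ge> 0"
  shows "(\<lambda>n. q ^ n * reg_Gamma_half n y) sums
           ((erf (sqrt y) - sqrt q * exp (- y) * (exp (q * y) * erf (sqrt (q * y)))) / (1 - q))"
proof -
  define S where "S = (\<Sum>n. q ^ n * reg_Gamma_half n y)"
  have "summable (\<lambda>n. q ^ n * reg_Gamma_half n y)"
  proof (rule summable_comparison_test'[OF summable_reg_Gamma_half[OF assms(3)]])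
    show "norm (q ^ n * reg_Gamma_half n y) \<le> reg_Gamma_half n y" for n
      using assms reg_Gamma_half_nonneg[of y n]
      by (simp add: abs_mult mult_left_le_one_le power_le_one)
  qed
  then have S: "(\<lambda>n. q ^ n * reg_Gamma_half n y) sums S"
    unfolding S_def by (rule summable_sums)
  \<comment> \<open>The shifted series loses exactly its term at n = 0, which is
    \<open>erf (sqrt y)\<close>. Subtracting it from q * S leaves only differences of consecutive
    terms.\<close>
  have "(\<lambda>n. q ^ Suc n * reg_Gamma_half (Suc n) y) sums (S - erf (sqrt y))"
    using S reg_Gamma_half_0[OF assms(3)] by (subst sums_Suc_iff) simp
  from sums_diff[OF sums_mult[OF S, of q] this]
  have "(\<lambda>n. q ^ Suc n * (reg_Gamma_half n y - reg_Gamma_half (Suc n) y))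
      sums (q * S - (S - erf (sqrt y)))"
    by (simp add: algebra_simps)
  moreover have "q ^ Suc n * (reg_Gamma_half n y - reg_Gamma_half (Suc n) y) =
      sqrt q * exp (- y) * ((q * y) powr (real n + 1/2) / Gamma (real (Suc n) + 1/2))" for n
  proof -
    \<comment> \<open>The exponent n + 1 exceeds n + 1/2 by one half, whence the factor
      \<open>sqrt q\<close>; the rest merges with the power of y into a power of
      \<open>q * y\<close>. For q = 0 both sides vanish, and otherwise q is positive, as turning
      \<open>powr\<close> into a natural power requires.\<close>
    have "q ^ Suc n = sqrt q * q powr (real n + 1/2)"
    proof (cases "q = 0")
      case False
      then have "q powr (real n + 1/2) = q ^ n * sqrt q"
        using assms by (simp add: powr_add powr_half_sqrt powr_realpow)
      then show ?thesis using assms by simp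
    qed simp
    then show ?thesis
      using assms by (simp only: reg_Gamma_half_diff powr_mult) simp
  qed
  moreover have "(\<lambda>n. sqrt q * exp (- y) *
      ((q * y) powr (real n + 1/2) / Gamma (real (Suc n) + 1/2)))
      sums (sqrt q * exp (- y) * (exp (q * y) * erf (sqrt (q * y))))"
    using assms by (intro sums_mult exp_mult_erf_sqrt_sums) simp
  ultimately have "q * S - (S - erf (sqrt y)) =
      sqrt q * exp (- y) * (exp (q * y) * erf (sqrt (q * y)))"
    by (simp only: sums_unique2)
  then have "S = (erf (sqrt y) - sqrt q * exp (- y) * (exp (q * y) * erf (sqrt (q * y)))) / (1 - q)"
    using assms by (simp add: field_simps)
  with S show ?thesis by simp
qed

theorem mainTheorem1:
  fixes \<beta> t :: real
  assumes "t > 0"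
  shows "(\<lambda>n::nat. (\<beta>\<^sup>2 / (1 + \<beta>\<^sup>2)) ^ n *
            (lower_Gamma (real n + 1/2) ((1 + \<beta>\<^sup>2) * t) / Gamma (real n + 1/2)))
         sums
         ((1 + \<beta>\<^sup>2) * erf (sqrt ((1 + \<beta>\<^sup>2) * t))
            - exp (- t) * \<beta> * sqrt (1 + \<beta>\<^sup>2) * erf (\<beta> * sqrt t))"
proof -
  define a where "a = 1 + \<beta>\<^sup>2"
  define q where "q = \<beta>\<^sup>2 / a"
  have a: "a > 0" and "0 \<le> q" "q < 1"
    by (auto simp: a_def q_def add_pos_nonneg)
  have qy: "q * (a * t) = \<beta>\<^sup>2 * t"
    using a by (simp add: q_def)
  have "1 - q = (a - \<beta>\<^sup>2) / a"
    using a by (simp add: q_def diff_divide_distrib)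
  then have q1: "1 - q = 1 / a"
    by (simp add: a_def)
  have "a * sqrt q = \<bar>\<beta>\<bar> * (a / sqrt a)"
    by (simp add: q_def real_sqrt_divide)
  then have aq: "a * sqrt q = \<bar>\<beta>\<bar> * sqrt a"
    using a by (simp add: real_div_sqrt)
  have "exp (- (a * t)) * exp (\<beta>\<^sup>2 * t) = exp (- t)"
    by (simp add: a_def algebra_simps flip: exp_add)
  \<comment> \<open>Both factors change sign with \<beta>, so the product is even in
    \<beta>.\<close>
  moreover have "\<bar>\<beta>\<bar> * erf (\<bar>\<beta>\<bar> * sqrt t) = \<beta> * erf (\<beta> * sqrt t)"
    using erf_minus[of "\<beta> * sqrt t"] by (auto simp: abs_if)
  \<comment> \<open>Dividing by 1 - q means multiplying by a. Here E stands for
    \<open>erf (sqrt (a * t))\<close>, u and v for the two exponentials, and w for the remaining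
    error function value; the regrouping brings together the pairs evaluated above.\<close>
  moreover have "a * (E - sqrt q * u * (v * w)) = a * E - (u * v) * (\<bar>\<beta>\<bar> * w) * sqrt a" for E u v w
  proof -
    have "a * (E - sqrt q * u * (v * w)) = a * E - (u * v) * (a * sqrt q) * w"
      by (simp add: algebra_simps)
    then show ?thesis
      by (simp only: aq) simp
  qed
  ultimately have "a * (E - sqrt q * exp (- (a * t)) * (exp (\<beta>\<^sup>2 * t) * erf (\<bar>\<beta>\<bar> * sqrt t))) =
      a * E - exp (- t) * \<beta> * sqrt a * erf (\<beta> * sqrt t)" for E
    by (simp only:) simp
  then have "(erf (sqrt (a * t)) -
      sqrt q * exp (- (a * t)) * (exp (q * (a * t)) * erf (sqrt (q * (a * t))))) / (1 - q) =
      a * erf (sqrt (a * t)) - exp (- t) * \<beta> * sqrt a * erf (\<beta> * sqrt t)"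
    unfolding qy q1 by (simp add: real_sqrt_mult mult.commute[of _ a])
  with power_mult_reg_Gamma_half_sums[OF \<open>0 \<le> q\<close> \<open>q < 1\<close>, of "a * t"] a assms
  show ?thesis
    by (simp add: reg_Gamma_half_def q_def a_def)
qed

end
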